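(* Let $(X,\mathfrak{B})$ and $r\colon X\to X$ be as in the context, and let $V\colon X\to[0,\infty)$ be bounded and $\mathfrak{B}$-measurable. Let $\mu_0$ be a measure on $(X,\mathfrak{B})$ with the fixed-point property $$\int_XV\,f\circ r\,d\mu_0=\int_Xf\,d\mu_0\qquad\text{for all }f\in L^\infty(X,\mu_0).$$ Let $\Delta\colon X\to[0,1]$ be the function associated to $V$ and $\mu_0$, i.e., a measurable function with $$\sum_{r(y)=x}\Delta(y)=1\quad(x\in X),\qquad \int_XV\,f\,d\mu_0=\int_X\sum_{r(y)=x}\Delta(y)f(y)\,d\mu_0(x)\quad\text{for all }f\in L^\infty(X,\mu_0),$$ and let $\hat\mu$ be the unique $V$-quasi-invariant measure on $X_\infty(r)$ with $\hat\mu\circ\theta_0^{-1}=\mu_0$. For $x_0\in X$ let $P_{x_0}$ be the Radon probability measure on $\Omega_{x_0}$ determined by $$\int_{\Omega_{x_0}}f(\omega)\,dP_{x_0}(\omega)=\sum_{r^n(x_n)=x_0}\Delta^{(n)}(x_n)f(x_1,\dots,x_n)$$ for bounded measurable $f$ on $\Omega_{x_0}$ depending only on the first $n$ coordinates $x_1,\dots,x_n$, $n\in\mathbb{N}$. Then, for all bounded measurable functions $f$ on $X_\infty(r)$, $$\int_{X_\infty(r)}f\,d\hat\mu=\int_X\int_{\Omega_{x_0}}f(x_0,\omega)\,dP_{x_0}(\omega)\,d\mu_0(x_0).$$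
   Context: $X$ is a non-empty set, $\mathfrak{B}$ a $\sigma$-algebra of subsets of $X$, and $r\colon X\to X$ an onto, finite-to-one, $\mathfrak{B}$-measurable map whose inverse branches can be labelled measurably: $\mathfrak{c}(x)=\#\,r^{-1}(x)$ is measurable, and with $A_i=\{x\mid\mathfrak{c}(x)\ge i\}$ there are measurable maps $\tau_i\colon A_i\to X$ with $r^{-1}(x)=\{\tau_1(x),\dots,\tau_{\mathfrak{c}(x)}(x)\}$ (without repetitions) and $\tau_i(A_i)\in\mathfrak{B}$. Measures are positive and finite. $X_\infty(r)=\{(x_0,x_1,\dots)\in\prod_{n\ge0}X\mid r(x_{n+1})=x_n\ \forall n\ge0\}$, $\theta_n(x_0,x_1,\dots)=x_n$, with the $\sigma$-algebra $\mathfrak{B}_\infty$ generated by all $\theta_n^{-1}(\mathfrak{B})$; $\hat r(x_0,x_1,\dots)=(r(x_0),x_0,x_1,\dots)$. A measure $\hat\mu$ on $(X_\infty(r),\mathfrak{B}_\infty)$ is $V$-quasi-invariant if $d(\hat\mu\circ\hat r)=V\circ\theta_0\,d\hat\mu$, where $(\hat\mu\circ\hat r)(E)=\hat\mu(\hat r(E))$. Measures $\mu_0$ with the fixed-point property correspond bijectively to $V$-quasi-invariant $\hat\mu$ via $\mu_0=\hat\mu\circ\theta_0^{-1}$. $\Omega_{x_0}=\{(x_1,x_2,\dots)\mid r(x_1)=x_0,\ r(x_{n+1})=x_n\ \forall n\ge1\}$, topologized as a subspace of the product of the finite discrete sets $r^{-n}(x_0)$; for $\omega=(x_1,x_2,\dots)\in\Omega_{x_0}$,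 $(x_0,\omega)=(x_0,x_1,x_2,\dots)\in X_\infty(r)$. $\Delta^{(n)}:=\Delta\cdot(\Delta\circ r)\cdots(\Delta\circ r^{n-1})$, and in the sum over $x_n$ with $r^n(x_n)=x_0$ one sets $x_k=r^{n-k}(x_n)$. *)

theory Defs
  imports "HOL-Probability.Probability"
begin

text \<open>
  The measurable space \<open>(X, \<BB>)\<close> is a measure \<open>M\<close> of which only \<open>space M\<close> and
  \<open>sets M\<close> are used; measures on \<open>(X, \<BB>)\<close> have \<open>sets \<mu> = sets M\<close>.
\<close>

definition iter_fiber :: "'a measure \<Rightarrow> ('a \<Rightarrow> 'a) \<Rightarrow> nat \<Rightarrow> 'a \<Rightarrow> 'a set" where
  "iter_fiber M r n x = {y \<in> space M. (r ^^ n) y = x}"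

abbreviation fiber :: "'a measure \<Rightarrow> ('a \<Rightarrow> 'a) \<Rightarrow> 'a \<Rightarrow> 'a set" where
  "fiber M r x \<equiv> iter_fiber M r 1 x"

definition branch_domain :: "'a measure \<Rightarrow> ('a \<Rightarrow> 'a) \<Rightarrow> nat \<Rightarrow> 'a set" where
  "branch_domain M r i = {x \<in> space M. i \<le> card (fiber M r x)}"

locale finite_to_one_endomorphism =
  fixes M :: "'a measure" and r :: "'a \<Rightarrow> 'a"
  assumes nonempty: "space M \<noteq> {}"
    and measurable_r: "r \<in> M \<rightarrow>\<^sub>M M"
    and onto: "r ` space M = space M"
    and finite_fiber: "\<And>x. x \<in> space M \<Longrightarrow> finite (fiber M r x)"
    and measurable_card: "(\<lambda>x. card (fiber M r x)) \<in> M \<rightarrow>\<^sub>M count_space UNIV"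
    and branches: "\<exists>\<tau> :: nat \<Rightarrow> 'a \<Rightarrow> 'a.
      (\<forall>i\<ge>1. \<tau> i \<in> restrict_space M (branch_domain M r i) \<rightarrow>\<^sub>M M \<and>
             \<tau> i ` branch_domain M r i \<in> sets M) \<and>
      (\<forall>x\<in>space M. bij_betw (\<lambda>i. \<tau> i x) {1..card (fiber M r x)} (fiber M r x))"

text \<open>
  Representatives of the elements of \<open>L\<^sup>\<infinity>(X, \<mu>)\<close>, complex-valued.
\<close>

definition Linfty :: "'a measure \<Rightarrow> ('a \<Rightarrow> complex) set" where
  "Linfty \<mu> = {f \<in> borel_measurable \<mu>. \<exists>C. AE x in \<mu>. norm (f x) \<le> C}"

definition fixed_point_property :: "('a \<Rightarrow> 'a) \<Rightarrow> ('a \<Rightarrow> real) \<Rightarrow> 'a measure \<Rightarrow> bool" where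
  "fixed_point_property r V \<mu> \<longleftrightarrow>
     (\<forall>f\<in>Linfty \<mu>. (\<integral>x. complex_of_real (V x) * f (r x) \<partial>\<mu>) = (\<integral>x. f x \<partial>\<mu>))"

definition associated_function ::
    "'a measure \<Rightarrow> ('a \<Rightarrow> 'a) \<Rightarrow> ('a \<Rightarrow> real) \<Rightarrow> 'a measure \<Rightarrow> ('a \<Rightarrow> real) \<Rightarrow> bool" where
  "associated_function M r V \<mu> \<Delta> \<longleftrightarrow>
     \<Delta> \<in> borel_measurable M \<and>
     (\<forall>x\<in>space M. 0 \<le> \<Delta> x \<and> \<Delta> x \<le> 1) \<and>
     (\<forall>x\<in>space M. (\<Sum>y\<in>fiber M r x. \<Delta> y) = 1) \<and>
     (\<forall>f\<in>Linfty \<mu>. (\<integral>x. complex_of_real (V x) * f x \<partial>\<mu>) =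
        (\<integral>x. (\<Sum>y\<in>fiber M r x. complex_of_real (\<Delta> y) * f y) \<partial>\<mu>))"

definition path_space :: "'a measure \<Rightarrow> ('a \<Rightarrow> 'a) \<Rightarrow> (nat \<Rightarrow> 'a) set" where
  "path_space M r = {x. (\<forall>n. x n \<in> space M) \<and> (\<forall>n. r (x (Suc n)) = x n)}"

definition path_algebra :: "'a measure \<Rightarrow> ('a \<Rightarrow> 'a) \<Rightarrow> (nat \<Rightarrow> 'a) measure" where
  "path_algebra M r = sigma (path_space M r)
     {(\<lambda>x. x n) -` B \<inter> path_space M r | n B. B \<in> sets M}"

definition path_map :: "('a \<Rightarrow> 'a) \<Rightarrow> (nat \<Rightarrow> 'a) \<Rightarrow> (nat \<Rightarrow> 'a)" where
  "path_map r x = case_nat (r (x 0)) x"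

text \<open>
  On \<open>path_space M r\<close> the map \<open>path_map r\<close> is a bijection with measurable inverse, so
  \<open>E \<mapsto> \<nu> (path_map r ` E)\<close> is a measure; it is required to agree with the density on
  every measurable set.
\<close>

definition quasi_invariant ::
    "'a measure \<Rightarrow> ('a \<Rightarrow> 'a) \<Rightarrow> ('a \<Rightarrow> real) \<Rightarrow> (nat \<Rightarrow> 'a) measure \<Rightarrow> bool" where
  "quasi_invariant M r V \<nu> \<longleftrightarrow>
     sets \<nu> = sets (path_algebra M r) \<and>
     (\<forall>E\<in>sets \<nu>. emeasure \<nu> (path_map r ` E) =
        emeasure (density \<nu> (\<lambda>x. ennreal (V (x 0)))) E)"

text \<open>
  Elements \<open>(x\<^sub>1, x\<^sub>2, \<dots>)\<close> of \<open>\<Omega>\<^bsub>x\<^esub>\<close> are shifted by one: \<open>\<omega> k\<close> is the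
  coordinate \<open>x\<^bsub>k+1\<^esub>\<close>, so that \<open>(x, \<omega>)\<close> is \<open>case_nat x \<omega>\<close>.
\<close>

definition Omega :: "'a measure \<Rightarrow> ('a \<Rightarrow> 'a) \<Rightarrow> 'a \<Rightarrow> (nat \<Rightarrow> 'a) set" where
  "Omega M r x = {\<omega>. (\<forall>k. \<omega> k \<in> space M) \<and> r (\<omega> 0) = x \<and> (\<forall>k. r (\<omega> (Suc k)) = \<omega> k)}"

definition Omega_topology :: "'a measure \<Rightarrow> ('a \<Rightarrow> 'a) \<Rightarrow> 'a \<Rightarrow> (nat \<Rightarrow> 'a) topology" where
  "Omega_topology M r x = subtopology
     (product_topology (\<lambda>k. discrete_topology (iter_fiber M r (Suc k) x)) UNIV)
     (Omega M r x)"

definition borel_algebra_of :: "'b topology \<Rightarrow> 'b measure" where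
  "borel_algebra_of T = sigma (topspace T) {U. openin T U}"

text \<open>
  For Hausdorff \<open>T\<close>, where compact sets are closed and hence Borel.
\<close>

definition radon_probability :: "'b topology \<Rightarrow> 'b measure \<Rightarrow> bool" where
  "radon_probability T P \<longleftrightarrow>
     prob_space P \<and> sets P = sets (borel_algebra_of T) \<and>
     (\<forall>E\<in>sets P. emeasure P E = (SUP K\<in>{K. compactin T K \<and> K \<subseteq> E}. emeasure P K))"

definition cocycle :: "('a \<Rightarrow> 'a) \<Rightarrow> ('a \<Rightarrow> real) \<Rightarrow> nat \<Rightarrow> 'a \<Rightarrow> real" where
  "cocycle r \<Delta> n y = (\<Prod>k<n. \<Delta> ((r ^^ k) y))"

text \<open>
  A function of \<open>\<omega>\<close> depending only on the first \<open>n\<close> coordinates is written as \<open>g\<close> applied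
  to the list \<open>[x\<^sub>1, \<dots>, x\<^sub>n]\<close>; in the sum over \<open>y = x\<^sub>n\<close> the \<open>k\<close>-th entry (from 1)
  of the list is \<open>(r ^^ (n - k)) y\<close>.
\<close>

definition path_measure ::
    "'a measure \<Rightarrow> ('a \<Rightarrow> 'a) \<Rightarrow> ('a \<Rightarrow> real) \<Rightarrow> 'a \<Rightarrow> (nat \<Rightarrow> 'a) measure \<Rightarrow> bool" where
  "path_measure M r \<Delta> x P \<longleftrightarrow>
     radon_probability (Omega_topology M r x) P \<and>
     (\<forall>n\<ge>1. \<forall>g :: 'a list \<Rightarrow> complex.
        (\<lambda>\<omega>. g (map \<omega> [0..<n])) \<in> borel_measurable P \<longrightarrow>
        (\<exists>C. \<forall>\<omega>\<in>Omega M r x. norm (g (map \<omega> [0..<n])) \<le> C) \<longrightarrow>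
        (\<integral>\<omega>. g (map \<omega> [0..<n]) \<partial>P) =
          (\<Sum>y\<in>iter_fiber M r n x. complex_of_real (cocycle r \<Delta> n y) *
             g (map (\<lambda>k. (r ^^ (n - k)) y) [1..<Suc n])))"

end

theory Submission
  imports Defs
begin

text \<open>
  On a path, \<open>x n\<close> determines \<open>x 0, \<dots>, x (n - 1)\<close>, so the sets \<open>{x. x n \<in> B}\<close> form an Int-stable
  generator of the path algebra and it suffices to compare the laws of the coordinates.
  With \<open>R g x = (\<Sum>y\<in>fiber M r x. \<Delta> y * g y)\<close>, the law of \<open>x n\<close> under
  \<open>\<integral> P x d\<mu>\<^sub>0\<close> is \<open>g \<mapsto> \<integral> R\<^sup>n g d\<mu>\<^sub>0\<close>. Quasi-invariance turns the law of \<open>x (n + 1)\<close>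
  under \<open>\<mu>_hat\<close> into the law of \<open>x n\<close> with density \<open>V (x 0) = V (r\<^sup>n (x n))\<close>, and
  \<open>\<integral> R\<^sup>n ((V \<circ> r\<^sup>n) * g) d\<mu>\<^sub>0 = \<integral> V * R\<^sup>n g d\<mu>\<^sub>0 = \<integral> R\<^sup>n\<^sup>+\<^sup>1 g d\<mu>\<^sub>0\<close>.
\<close>

section \<open>The path algebra and its one-coordinate cylinders\<close>

definition transfer ::
    "'a measure \<Rightarrow> ('a \<Rightarrow> 'a) \<Rightarrow> ('a \<Rightarrow> real) \<Rightarrow> nat \<Rightarrow> ('a \<Rightarrow> ennreal) \<Rightarrow> 'a \<Rightarrow> ennreal" where
  "transfer M r \<Delta> n g x = (\<Sum>y\<in>iter_fiber M r n x. ennreal (cocycle r \<Delta> n y) * g y)"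

definition cylinders :: "'a measure \<Rightarrow> ('a \<Rightarrow> 'a) \<Rightarrow> (nat \<Rightarrow> 'a) set set" where
  "cylinders M r = {(\<lambda>x. x n) -` B \<inter> path_space M r | n B. B \<in> sets M}"

lemma cylinders_subset: "cylinders M r \<subseteq> Pow (path_space M r)"
  by (auto simp: cylinders_def)

lemma space_path_algebra [simp]: "space (path_algebra M r) = path_space M r"
  using cylinders_subset[of M r] by (simp add: path_algebra_def cylinders_def)

lemma sets_path_algebra: "sets (path_algebra M r) = sigma_sets (path_space M r) (cylinders M r)"
  using cylinders_subset[of M r] by (simp add: path_algebra_def cylinders_def)

lemma cylinder_in_path_algebra:
  "B \<in> sets M \<Longrightarrow> (\<lambda>x. x n) -` B \<inter> path_space M r \<in> sets (path_algebra M r)"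
  unfolding sets_path_algebra by (rule sigma_sets.Basic) (auto simp: cylinders_def)

lemma measurable_coordinate: "(\<lambda>x. x n) \<in> path_algebra M r \<rightarrow>\<^sub>M M"
proof (rule measurableI)
  show "x n \<in> space M" if "x \<in> space (path_algebra M r)" for x
    using that by (simp add: path_space_def)
qed (simp add: cylinder_in_path_algebra)

lemma path_space_funpow:
  assumes "x \<in> path_space M r"
  shows "(r ^^ k) (x (n + k)) = x n"
  using assms by (induction k arbitrary: n) (auto simp: path_space_def funpow_swap1)

text \<open>The exponent is \<open>Suc k\<close> because \<open>\<omega> k\<close> stands for the
  coordinate with index k+1. This places \<open>\<omega> k\<close> in the discrete factor
  \<open>iter_fiber M r (Suc k) x\<close> of the product topology.\<close>

lemma Omega_funpow:
  assumes "\<omega> \<in> Omega M r x"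
  shows "(r ^^ Suc k) (\<omega> k) = x"
proof (induction k)
  case 0
  then show ?case using assms by (simp add: Omega_def)
next
  case (Suc k)
  have "(r ^^ Suc (Suc k)) (\<omega> (Suc k)) = (r ^^ Suc k) (r (\<omega> (Suc k)))"
    by (simp only: funpow_Suc_right o_def)
  also have "r (\<omega> (Suc k)) = \<omega> k"
    using assms by (simp add: Omega_def)
  finally show ?case using Suc by simp
qed

lemma case_nat_in_path_space:
  assumes "x \<in> space M" "\<omega> \<in> Omega M r x"
  shows "case_nat x \<omega> \<in> path_space M r"
  using assms by (auto simp: path_space_def Omega_def split: nat.split)

text \<open>On paths, dropping the head inverts \<open>path_map r\<close>, since
  \<open>r (z 1) = z 0\<close> recovers the head. A constraint at index \<open>n\<close> thus moves
  to index \<open>Suc n\<close>, which is the form in which quasi-invariance is exploited.\<close>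

lemma path_map_cylinder:
  assumes r: "r \<in> space M \<rightarrow> space M"
  shows "path_map r ` ((\<lambda>x. x n) -` B \<inter> path_space M r) =
    (\<lambda>x. x (Suc n)) -` B \<inter> path_space M r"
proof (intro equalityI subsetI)
  fix z assume "z \<in> path_map r ` ((\<lambda>x. x n) -` B \<inter> path_space M r)"
  then show "z \<in> (\<lambda>x. x (Suc n)) -` B \<inter> path_space M r"
    using r by (auto simp: path_map_def path_space_def split: nat.split)
next
  fix z assume z: "z \<in> (\<lambda>x. x (Suc n)) -` B \<inter> path_space M r"
  then have "z = path_map r (\<lambda>k. z (Suc k))"
    by (auto simp: path_map_def path_space_def fun_eq_iff split: nat.split)
  moreover have "(\<lambda>k. z (Suc k)) \<in> (\<lambda>x. x n) -` B \<inter> path_space M r"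
    using z by (auto simp: path_space_def)
  ultimately show "z \<in> path_map r ` ((\<lambda>x. x n) -` B \<inter> path_space M r)"
    by blast
qed

section \<open>Borel sets of \<open>Omega\<close> and the path measures\<close>

lemma topspace_Omega_topology: "topspace (Omega_topology M r x) = Omega M r x"
proof -
  \<comment> \<open>A subtopology keeps only points of its ambient topspace, so \<open>Omega\<close>
    has to lie inside the product of the iterated fibers for no path to be lost.\<close>
  have "Omega M r x \<subseteq> (\<Pi>\<^sub>E k\<in>UNIV. iter_fiber M r (Suc k) x)"
    using Omega_funpow[of _ M r x] by (auto simp: iter_fiber_def Omega_def simp del: funpow.simps)
  then show ?thesis
    by (auto simp: Omega_topology_def)
qed

lemma space_borel_algebra_of: "space (borel_algebra_of T) = topspace T"
  unfolding borel_algebra_of_def by (rule space_measure_of) (auto dest: openin_subset)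

lemma openin_borel_algebra_of: "openin T U \<Longrightarrow> U \<in> sets (borel_algebra_of T)"
  unfolding borel_algebra_of_def by (subst sets_measure_of) (auto dest: openin_subset)

text \<open>The coordinate map is continuous into a discrete space, so the preimage of any set
  whatsoever is open. Intersecting \<open>B\<close> with the iterated fiber changes nothing, as
  \<open>\<omega> k\<close> always lies there.\<close>

lemma Omega_coordinate_borel:
  "{\<omega> \<in> Omega M r x. \<omega> k \<in> B} \<in> sets (borel_algebra_of (Omega_topology M r x))"
proof (rule openin_borel_algebra_of)
  have "continuous_map (Omega_topology M r x) (discrete_topology (iter_fiber M r (Suc k) x))
      (\<lambda>\<omega>. \<omega> k)"
    unfolding Omega_topology_def
    by (intro continuous_map_from_subtopology continuous_map_product_projection) simp
  then have "openin (Omega_topology M r x)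
      {\<omega> \<in> topspace (Omega_topology M r x). \<omega> k \<in> B \<inter> iter_fiber M r (Suc k) x}"
    by (rule openin_continuous_map_preimage) simp
  also have "{\<omega> \<in> topspace (Omega_topology M r x). \<omega> k \<in> B \<inter> iter_fiber M r (Suc k) x} =
      {\<omega> \<in> Omega M r x. \<omega> k \<in> B}"
    using Omega_funpow[of _ M r x k]
    by (auto simp: topspace_Omega_topology iter_fiber_def Omega_def simp del: funpow.simps)
  finally show "openin (Omega_topology M r x) {\<omega> \<in> Omega M r x. \<omega> k \<in> B}" .
qed

lemma path_measureD:
  assumes P: "path_measure M r \<Delta> x P"
  shows "prob_space P"
    and "sets P = sets (borel_algebra_of (Omega_topology M r x))"
    and "space P = Omega M r x"
    and "\<And>n g. n \<ge> 1 \<Longrightarrow> (\<lambda>\<omega>. g (map \<omega> [0..<n])) \<in> borel_measurable P \<Longrightarrow>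
      \<exists>C. \<forall>\<omega>\<in>Omega M r x. norm (g (map \<omega> [0..<n])) \<le> C \<Longrightarrow>
      (\<integral>\<omega>. g (map \<omega> [0..<n]) \<partial>P) = (\<Sum>y\<in>iter_fiber M r n x.
        complex_of_real (cocycle r \<Delta> n y) * g (map (\<lambda>k. (r ^^ (n - k)) y) [1..<Suc n]))"
proof -
  show "prob_space P" and sets: "sets P = sets (borel_algebra_of (Omega_topology M r x))"
    using P unfolding path_measure_def radon_probability_def by blast+
  show "space P = Omega M r x"
    using sets_eq_imp_space_eq[OF sets] by (simp add: space_borel_algebra_of topspace_Omega_topology)
qed (use P in \<open>unfold path_measure_def, blast\<close>)

text \<open>It suffices to test generating cylinders. At index 0 the path
  \<open>case_nat x \<omega>\<close> has the constant entry \<open>x\<close>, so the preimage is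
  everything or empty; at index \<open>Suc k\<close> it is an open set determined by
  \<open>\<omega> k\<close>.\<close>

lemma measurable_case_nat_Omega:
  assumes x: "x \<in> space M" and P: "sets P = sets (borel_algebra_of (Omega_topology M r x))"
  shows "case_nat x \<in> P \<rightarrow>\<^sub>M path_algebra M r"
proof (rule measurable_sigma_sets[OF sets_path_algebra cylinders_subset])
  have sp: "space P = Omega M r x"
    using sets_eq_imp_space_eq[OF P] by (simp add: space_borel_algebra_of topspace_Omega_topology)
  show "case_nat x \<in> space P \<rightarrow> path_space M r"
    using x by (auto simp: sp case_nat_in_path_space)
  fix A assume "A \<in> cylinders M r"
  then obtain n B where A: "A = (\<lambda>x. x n) -` B \<inter> path_space M r"
    by (auto simp: cylinders_def)
  show "case_nat x -` A \<inter> space P \<in> sets P"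
  proof (cases n)
    case 0
    then have "case_nat x -` A \<inter> space P = (if x \<in> B then space P else {})"
      using x by (auto simp: A sp case_nat_in_path_space)
    then show ?thesis by simp
  next
    case (Suc k)
    then have "case_nat x -` A \<inter> space P = {\<omega> \<in> Omega M r x. \<omega> k \<in> B}"
      using x by (auto simp: A sp case_nat_in_path_space)
    then show ?thesis by (simp add: P Omega_coordinate_borel)
  qed
qed

lemma cocycle_nonneg:
  assumes "r \<in> space M \<rightarrow> space M" "\<And>x. x \<in> space M \<Longrightarrow> 0 \<le> \<Delta> x" "y \<in> space M"
  shows "0 \<le> cocycle r \<Delta> n y"
proof -
  have "(r ^^ k) y \<in> space M" for k
    using assms(1,3) by (induction k) auto
  then show ?thesis
    using assms(2) by (auto simp: cocycle_def intro!: prod_nonneg)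
qed

lemma associated_functionD:
  assumes "associated_function M r V \<mu> \<Delta>"
  shows "\<Delta> \<in> borel_measurable M"
    and "\<And>x. x \<in> space M \<Longrightarrow> 0 \<le> \<Delta> x"
    and "\<And>x. x \<in> space M \<Longrightarrow> (\<Sum>y\<in>fiber M r x. \<Delta> y) = 1"
    and "\<And>f. f \<in> Linfty \<mu> \<Longrightarrow> (\<integral>x. complex_of_real (V x) * f x \<partial>\<mu>) =
        (\<integral>x. (\<Sum>y\<in>fiber M r x. complex_of_real (\<Delta> y) * f y) \<partial>\<mu>)"
  using assms unfolding associated_function_def by blast+

section \<open>Intersection stability, iterated fibers and the transfer operator\<close>

context finite_to_one_endomorphism
begin

lemma r_space: "r \<in> space M \<rightarrow> space M"
  using measurable_space[OF measurable_r] by (rule Pi_I)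

lemma funpow_r_space: "y \<in> space M \<Longrightarrow> (r ^^ n) y \<in> space M"
  using r_space by (induction n) auto

lemma measurable_funpow_r: "(r ^^ n) \<in> M \<rightarrow>\<^sub>M M"
  using measurable_r by (simp add: measurable_compose_n)

text \<open>For \<open>n \<le> m\<close> the constraint at index \<open>n\<close> is pulled back
  along \<open>r ^^ (m - n)\<close> to index \<open>m\<close>. Both constraints then bear on one
  coordinate, and measurability of the iterates of \<open>r\<close> keeps the combined set in
  \<open>M\<close>.\<close>

lemma Int_stable_cylinders: "Int_stable (cylinders M r)"
proof (rule Int_stableI)
  have *: "((\<lambda>x. x n) -` A \<inter> path_space M r) \<inter> ((\<lambda>x. x m) -` B \<inter> path_space M r) \<in> cylinders M r"
    if A: "A \<in> sets M" and B: "B \<in> sets M" and "n \<le> m" for n m A B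
  proof -
    let ?C = "(r ^^ (m - n)) -` A \<inter> space M \<inter> B"
    have "(r ^^ (m - n)) (x m) = x n" "x m \<in> space M" if "x \<in> path_space M r" for x
      using path_space_funpow[OF that, of "m - n" n] \<open>n \<le> m\<close> that
      by (simp, simp add: path_space_def)
    then have "((\<lambda>x. x n) -` A \<inter> path_space M r) \<inter> ((\<lambda>x. x m) -` B \<inter> path_space M r) =
        (\<lambda>x. x m) -` ?C \<inter> path_space M r"
      by (intro set_eqI) auto
    moreover have "?C \<in> sets M"
      using measurable_sets[OF measurable_funpow_r A] B by (rule sets.Int)
    ultimately show ?thesis
      unfolding cylinders_def by blast
  qed
  fix a b assume "a \<in> cylinders M r" "b \<in> cylinders M r"
  then obtain n A m B where ab: "a = (\<lambda>x. x n) -` A \<inter> path_space M r" "A \<in> sets M"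
    "b = (\<lambda>x. x m) -` B \<inter> path_space M r" "B \<in> sets M"
    unfolding cylinders_def by blast
  show "a \<inter> b \<in> cylinders M r"
  proof (cases "n \<le> m")
    case True
    then show ?thesis using *[of A B n m] ab by simp
  next
    case False
    then show ?thesis using *[of B A m n] ab by (simp add: Int_commute)
  qed
qed

lemma finite_iter_fiber: "x \<in> space M \<Longrightarrow> finite (iter_fiber M r n x)"
proof (induction n arbitrary: x)
  case 0
  then show ?case by (auto simp: iter_fiber_def)
next
  case (Suc n)
  have "iter_fiber M r (Suc n) x \<subseteq> (\<Union>z\<in>fiber M r x. iter_fiber M r n z)"
    using funpow_r_space by (auto simp: iter_fiber_def)
  moreover have "finite (\<Union>z\<in>fiber M r x. iter_fiber M r n z)"
    using finite_fiber[OF Suc.prems] Suc.IH by (auto simp: iter_fiber_def)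
  ultimately show ?case by (rule finite_subset)
qed

lemma transfer_0: "x \<in> space M \<Longrightarrow> transfer M r \<Delta> 0 g x = g x"
proof -
  assume "x \<in> space M"
  then have "iter_fiber M r 0 x = {x}" by (auto simp: iter_fiber_def)
  then show ?thesis by (simp add: transfer_def cocycle_def)
qed

text \<open>The closed sum defining \<open>transfer\<close> is an iterate of the one-step operator:
  the fiber of \<open>r ^^ Suc n\<close> splits according to the intermediate point
  \<open>z = (r ^^ n) y\<close>, and the cocycle at \<open>y\<close> factors as
  \<open>\<Delta> z\<close> times the cocycle of length \<open>n\<close>.\<close>

lemma transfer_Suc:
  assumes x: "x \<in> space M" and \<Delta>: "\<And>x. x \<in> space M \<Longrightarrow> 0 \<le> \<Delta> x"
  shows "transfer M r \<Delta> (Suc n) g x = transfer M r \<Delta> 1 (transfer M r \<Delta> n g) x"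
proof -
  have fin: "finite (fiber M r x)" "\<And>z. z \<in> fiber M r x \<Longrightarrow> finite (iter_fiber M r n z)"
    using finite_fiber[OF x] finite_iter_fiber by (blast, simp add: iter_fiber_def)
  have un: "iter_fiber M r (Suc n) x = (\<Union>z\<in>fiber M r x. iter_fiber M r n z)"
    using funpow_r_space by (auto simp: iter_fiber_def)
  have "transfer M r \<Delta> (Suc n) g x =
      (\<Sum>z\<in>fiber M r x. \<Sum>y\<in>iter_fiber M r n z. ennreal (cocycle r \<Delta> (Suc n) y) * g y)"
    unfolding transfer_def un by (rule sum.UNION_disjoint) (use fin in \<open>auto simp: iter_fiber_def\<close>)
  also have "\<dots> = (\<Sum>z\<in>fiber M r x. \<Sum>y\<in>iter_fiber M r n z.
      ennreal (\<Delta> z) * (ennreal (cocycle r \<Delta> n y) * g y))"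
  proof (intro sum.cong refl)
    fix z y assume "z \<in> fiber M r x" "y \<in> iter_fiber M r n z"
    then have "y \<in> space M" "z \<in> space M" "(r ^^ n) y = z" by (auto simp: iter_fiber_def)
    \<comment> \<open>\<open>ennreal\<close> sends negative reals to 0; nonnegativity of the factors
      is what lets it split over their product.\<close>
    moreover have "0 \<le> cocycle r \<Delta> n y"
      using r_space \<Delta> \<open>y \<in> space M\<close> by (rule cocycle_nonneg)
    moreover have "cocycle r \<Delta> (Suc n) y = \<Delta> ((r ^^ n) y) * cocycle r \<Delta> n y"
      by (simp add: cocycle_def)
    ultimately show "ennreal (cocycle r \<Delta> (Suc n) y) * g y =
        ennreal (\<Delta> z) * (ennreal (cocycle r \<Delta> n y) * g y)"
      using \<Delta> by (simp add: ennreal_mult mult.assoc)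
  qed
  also have "\<dots> = transfer M r \<Delta> 1 (transfer M r \<Delta> n g) x"
    by (simp add: transfer_def sum_distrib_left cocycle_def)
  finally show ?thesis .
qed

text \<open>Here the measurable labelling of the inverse branches enters: the sum over a fiber, an
  index set varying with \<open>x\<close>, becomes a sum over the labels from 1 to the cardinality
  of the fiber.\<close>

lemma measurable_fiber_sum:
  fixes h :: "'a \<Rightarrow> ennreal"
  assumes h: "h \<in> borel_measurable M"
  shows "(\<lambda>x. \<Sum>y\<in>fiber M r x. h y) \<in> borel_measurable M"
proof -
  obtain \<tau> :: "nat \<Rightarrow> 'a \<Rightarrow> 'a" where
    *: "(\<forall>i\<ge>1. \<tau> i \<in> restrict_space M (branch_domain M r i) \<rightarrow>\<^sub>M M \<and>
           \<tau> i ` branch_domain M r i \<in> sets M) \<and>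
      (\<forall>x\<in>space M. bij_betw (\<lambda>i. \<tau> i x) {1..card (fiber M r x)} (fiber M r x))"
    using branches by (elim exE)
  have \<tau>: "\<tau> i \<in> restrict_space M (branch_domain M r i) \<rightarrow>\<^sub>M M" if "i \<ge> 1" for i
    using conjunct1[OF *] that by simp
  have bij: "bij_betw (\<lambda>i. \<tau> i x) {1..card (fiber M r x)} (fiber M r x)" if "x \<in> space M" for x
    using conjunct2[OF *] that by (rule bspec)
  have dom: "branch_domain M r i \<in> sets M" for i
  proof -
    have "branch_domain M r i = (\<lambda>x. card (fiber M r x)) -` {i..} \<inter> space M"
      by (auto simp: branch_domain_def)
    then show ?thesis
      using measurable_sets[OF measurable_card, of "{i..}"] by simp
  qed
  \<comment> \<open>\<open>\<tau> i\<close> is measurable only on its branch domain. The indicator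
    makes the product vanish elsewhere and so yields a function measurable on all of
    \<open>M\<close>.\<close>
  have part: "(\<lambda>x. h (\<tau> i x) * indicator (branch_domain M r i) x) \<in> borel_measurable M"
    if "i \<ge> 1" for i
    using measurable_compose[OF \<tau>[OF that] h] dom
    by (intro borel_measurable_restrict_space_iff_ennreal[THEN iffD1] sets.Int sets.top)
  have sum_eq: "(\<Sum>y\<in>fiber M r x. h y) =
      (\<Sum>i\<in>{1..card (fiber M r x)}. h (\<tau> i x) * indicator (branch_domain M r i) x)"
    if "x \<in> space M" for x
  proof -
    have "(\<Sum>y\<in>fiber M r x. h y) = (\<Sum>i\<in>{1..card (fiber M r x)}. h (\<tau> i x))"
      by (rule sum.reindex_bij_betw[OF bij[OF that], symmetric])
    also have "\<dots> = (\<Sum>i\<in>{1..card (fiber M r x)}. h (\<tau> i x) * indicator (branch_domain M r i) x)"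
      using that by (intro sum.cong) (simp_all add: branch_domain_def)
    finally show ?thesis .
  qed
  \<comment> \<open>The number of summands is a measurable function of \<open>x\<close> with values
    in a countable set, so each fixed number \<open>k\<close> of summands may be treated
    separately.\<close>
  have "(\<lambda>x. \<Sum>i\<in>{1..card (fiber M r x)}. h (\<tau> i x) * indicator (branch_domain M r i) x)
      \<in> borel_measurable M"
  proof (rule measurable_compose_countable[OF _ measurable_card])
    show "(\<lambda>x. \<Sum>i\<in>{1..k}. h (\<tau> i x) * indicator (branch_domain M r i) x)
        \<in> borel_measurable M" for k
      by (rule borel_measurable_sum) (simp only: part atLeastAtMost_iff)
  qed
  then show ?thesis
    by (rule measurable_cong[THEN iffD2, rotated]) (rule sum_eq)
qed

lemma measurable_transfer:
  assumes \<Delta>: "\<Delta> \<in> borel_measurable M" "\<And>x. x \<in> space M \<Longrightarrow> 0 \<le> \<Delta> x"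
    and g: "g \<in> borel_measurable M"
  shows "transfer M r \<Delta> n g \<in> borel_measurable M"
proof (induction n)
  case 0
  show ?case
    using g by (simp add: transfer_0 cong: measurable_cong)
next
  case (Suc n)
  have "transfer M r \<Delta> 1 (transfer M r \<Delta> n g) \<in> borel_measurable M"
    unfolding transfer_def[of M r \<Delta> 1] cocycle_def
    using Suc \<Delta>(1) by (intro measurable_fiber_sum) simp
  then show ?case
    by (rule measurable_cong[THEN iffD2, rotated]) (rule transfer_Suc[OF _ \<Delta>(2)])
qed

text \<open>On the fiber over \<open>x\<close> the factor \<open>v ((r ^^ n) y)\<close> has the
  constant value \<open>v x\<close> and leaves the sum. With \<open>v\<close> taken from
  \<open>V\<close>, this pulls the density at the starting point out of the operator.\<close>

lemma transfer_funpow_mult: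
  "transfer M r \<Delta> n (\<lambda>y. v ((r ^^ n) y) * g y) x = v x * transfer M r \<Delta> n g x"
  by (auto simp: transfer_def sum_distrib_left iter_fiber_def mult_ac intro!: sum.cong)

text \<open>
  The identity for \<open>\<Delta>\<close> is only given for complex functions in \<open>L\<^sup>\<infinity>\<close>; boundedness of \<open>V\<close>
  makes the Bochner integral there agree with the nonnegative one.
\<close>

lemma nn_integral_transfer_indicator:
  assumes V: "V \<in> borel_measurable M" "\<And>x. x \<in> space M \<Longrightarrow> 0 \<le> V x" "\<And>x. x \<in> space M \<Longrightarrow> V x \<le> C"
    and \<mu>: "finite_measure \<mu>" "sets \<mu> = sets M"
    and \<Delta>: "associated_function M r V \<mu> \<Delta>"
    and A: "A \<in> sets M"
  shows "(\<integral>\<^sup>+x. ennreal (V x) * indicator A x \<partial>\<mu>) = (\<integral>\<^sup>+x. transfer M r \<Delta> 1 (indicator A) x \<partial>\<mu>)"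
proof -
  interpret finite_measure \<mu> by fact
  have sp: "space \<mu> = space M" by (rule sets_eq_imp_space_eq) fact
  note [measurable_cong] = \<mu>(2)
  note [measurable] = V(1) A
  note \<Delta>m = associated_functionD(1)[OF \<Delta>] and \<Delta>0 = associated_functionD(2)[OF \<Delta>]
    and \<Delta>1 = associated_functionD(3)[OF \<Delta>]
  define S where "S = (\<lambda>x. \<Sum>y\<in>fiber M r x. \<Delta> y * indicator A y)"
  have S0: "0 \<le> S x" for x
    unfolding S_def using \<Delta>0 by (intro sum_nonneg) (auto simp: iter_fiber_def)
  \<comment> \<open>The weights \<open>\<Delta>\<close> sum to 1 over the fiber and the indicator is
    at most 1; this bound serves the integrability of \<open>S\<close>.\<close>
  have S1: "S x \<le> 1" if "x \<in> space M" for x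
    unfolding S_def \<Delta>1[OF that, symmetric] using \<Delta>0
    by (intro sum_mono) (auto simp: iter_fiber_def indicator_def)
  have TS: "transfer M r \<Delta> 1 (indicator A) x = ennreal (S x)" for x
  proof -
    have "transfer M r \<Delta> 1 (indicator A) x = (\<Sum>y\<in>fiber M r x. ennreal (\<Delta> y * indicator A y))"
      unfolding transfer_def by (intro sum.cong) (auto simp: cocycle_def indicator_def)
    also have "\<dots> = ennreal (S x)"
      unfolding S_def using \<Delta>0 by (intro sum_ennreal) (simp add: iter_fiber_def)
    finally show ?thesis .
  qed
  have [measurable]: "transfer M r \<Delta> 1 (indicator A) \<in> borel_measurable M"
    using A by (intro measurable_transfer \<Delta>m \<Delta>0 borel_measurable_indicator)
  \<comment> \<open>Measurability of the real-valued \<open>S\<close> is read off from that of the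
    \<open>ennreal\<close>-valued transfer, which equals it up to the embedding.\<close>
  have "(\<lambda>x. enn2real (transfer M r \<Delta> 1 (indicator A) x)) \<in> borel_measurable M"
    by measurable
  then have Sm [measurable]: "S \<in> borel_measurable M"
    by (simp only: TS S0 enn2real_ennreal)
  \<comment> \<open>Off \<open>A\<close> the integrand is 0, which must be dominated too, hence
    \<open>max C 0\<close>.\<close>
  have VA: "integrable \<mu> (\<lambda>x. V x * indicator A x)"
    using V(2,3) by (intro integrable_const_bound[of _ "max C 0"] AE_I2) (auto simp: sp indicator_def le_max_iff_disj)
  have S: "integrable \<mu> S"
    using S0 S1 by (intro integrable_const_bound[of _ 1]) (auto simp: sp)
  have "(\<lambda>x. indicator A x :: complex) \<in> Linfty \<mu>"
    by (auto simp: Linfty_def indicator_def intro!: exI[of _ 1])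
  then have "(\<integral>x. complex_of_real (V x) * indicator A x \<partial>\<mu>) =
      (\<integral>x. (\<Sum>y\<in>fiber M r x. complex_of_real (\<Delta> y) * indicator A y) \<partial>\<mu>)"
    by (rule associated_functionD(4)[OF \<Delta>])
  then have "(\<integral>x. complex_of_real (V x * indicator A x) \<partial>\<mu>) = (\<integral>x. complex_of_real (S x) \<partial>\<mu>)"
    by (simp add: S_def of_real_indicator)
  then have "(\<integral>x. V x * indicator A x \<partial>\<mu>) = (\<integral>x. S x \<partial>\<mu>)"
    by (simp only: integral_complex_of_real of_real_eq_iff)
  moreover have "(\<integral>\<^sup>+x. ennreal (V x) * indicator A x \<partial>\<mu>) = (\<integral>\<^sup>+x. ennreal (V x * indicator A x) \<partial>\<mu>)"
    by (intro nn_integral_cong) (auto simp: indicator_def)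
  moreover have "\<dots> = ennreal (\<integral>x. V x * indicator A x \<partial>\<mu>)"
    using V(2) by (intro nn_integral_eq_integral[OF VA] AE_I2) (simp add: sp)
  moreover have "(\<integral>\<^sup>+x. transfer M r \<Delta> 1 (indicator A) x \<partial>\<mu>) = ennreal (\<integral>x. S x \<partial>\<mu>)"
    unfolding TS using S0 by (intro nn_integral_eq_integral[OF S] AE_I2)
  ultimately show ?thesis by simp
qed

text \<open>Both sides are additive, homogeneous and continuous along increasing sequences in
  \<open>h\<close>, so the indicator case spreads to all nonnegative measurable functions.\<close>

lemma nn_integral_transfer:
  assumes V: "V \<in> borel_measurable M" "\<And>x. x \<in> space M \<Longrightarrow> 0 \<le> V x" "\<And>x. x \<in> space M \<Longrightarrow> V x \<le> C"
    and \<mu>: "finite_measure \<mu>" "sets \<mu> = sets M"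
    and \<Delta>: "associated_function M r V \<mu> \<Delta>"
    and h: "h \<in> borel_measurable M"
  shows "(\<integral>\<^sup>+x. ennreal (V x) * h x \<partial>\<mu>) = (\<integral>\<^sup>+x. transfer M r \<Delta> 1 h x \<partial>\<mu>)"
  using h
proof (induction h rule: borel_measurable_induct)
  case (cong f g)
  have sp: "space \<mu> = space M" by (rule sets_eq_imp_space_eq) fact
  have "(\<integral>\<^sup>+x. ennreal (V x) * f x \<partial>\<mu>) = (\<integral>\<^sup>+x. ennreal (V x) * g x \<partial>\<mu>)"
    using cong(3) by (intro nn_integral_cong) (simp add: sp)
  moreover have "transfer M r \<Delta> 1 f x = transfer M r \<Delta> 1 g x" for x
    using cong(3) by (simp add: transfer_def iter_fiber_def)
  ultimately show ?case using cong(4) by simp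
next
  case (set A)
  show ?case by (rule nn_integral_transfer_indicator[OF V \<mu> \<Delta> set])
next
  case (mult u c)
  note [measurable_cong] = \<mu>(2)
  note [measurable] = V(1) mult(2)
  have [measurable]: "transfer M r \<Delta> 1 u \<in> borel_measurable M"
    using mult(2) by (intro measurable_transfer associated_functionD(1,2)[OF \<Delta>])
  have "(\<integral>\<^sup>+x. ennreal (V x) * (c * u x) \<partial>\<mu>) = (\<integral>\<^sup>+x. c * (ennreal (V x) * u x) \<partial>\<mu>)"
    by (simp add: mult_ac)
  also have "\<dots> = c * (\<integral>\<^sup>+x. transfer M r \<Delta> 1 u x \<partial>\<mu>)"
    using mult by (simp add: nn_integral_cmult)
  also have "\<dots> = (\<integral>\<^sup>+x. c * transfer M r \<Delta> 1 u x \<partial>\<mu>)"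
    by (rule nn_integral_cmult[symmetric]) measurable
  also have "(\<lambda>x. c * transfer M r \<Delta> 1 u x) = transfer M r \<Delta> 1 (\<lambda>x. c * u x)"
    by (simp add: transfer_def sum_distrib_left mult_ac fun_eq_iff)
  finally show ?case .
next
  case (add u v)
  note [measurable_cong] = \<mu>(2)
  note [measurable] = V(1) add(1,3)
  have [measurable]: "transfer M r \<Delta> 1 u \<in> borel_measurable M" "transfer M r \<Delta> 1 v \<in> borel_measurable M"
    using add(1,3) by (simp_all only: measurable_transfer associated_functionD(1,2)[OF \<Delta>])
  have "(\<integral>\<^sup>+x. ennreal (V x) * (v x + u x) \<partial>\<mu>) =
      (\<integral>\<^sup>+x. ennreal (V x) * v x \<partial>\<mu>) + (\<integral>\<^sup>+x. ennreal (V x) * u x \<partial>\<mu>)"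
    by (simp add: nn_integral_add distrib_left)
  also have "\<dots> = (\<integral>\<^sup>+x. transfer M r \<Delta> 1 v x \<partial>\<mu>) + (\<integral>\<^sup>+x. transfer M r \<Delta> 1 u x \<partial>\<mu>)"
    using add by simp
  also have "\<dots> = (\<integral>\<^sup>+x. transfer M r \<Delta> 1 v x + transfer M r \<Delta> 1 u x \<partial>\<mu>)"
    by (rule nn_integral_add[symmetric]) measurable
  also have "(\<lambda>x. transfer M r \<Delta> 1 v x + transfer M r \<Delta> 1 u x) = transfer M r \<Delta> 1 (\<lambda>x. v x + u x)"
    by (simp add: transfer_def sum.distrib distrib_left fun_eq_iff)
  finally show ?case .
next
  case (seq U)
  note [measurable_cong] = \<mu>(2)
  note [measurable] = V(1) seq(1)
  have [measurable]: "transfer M r \<Delta> 1 (U i) \<in> borel_measurable M" for i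
    using seq(1) by (intro measurable_transfer associated_functionD(1,2)[OF \<Delta>])
  have IH: "(\<integral>\<^sup>+x. ennreal (V x) * U i x \<partial>\<mu>) = (\<integral>\<^sup>+x. transfer M r \<Delta> 1 (U i) x \<partial>\<mu>)" for i
    by fact
  have U: "U i x \<le> U j x" if "i \<le> j" for i j x
    using \<open>incseq U\<close> that by (auto simp: incseq_def le_fun_def)
  have "(\<integral>\<^sup>+x. ennreal (V x) * (SUP i. U i) x \<partial>\<mu>) = (\<integral>\<^sup>+x. (SUP i. ennreal (V x) * U i x) \<partial>\<mu>)"
    by (simp add: SUP_mult_left_ennreal image_comp)
  also have "\<dots> = (SUP i. \<integral>\<^sup>+x. ennreal (V x) * U i x \<partial>\<mu>)"
    by (intro nn_integral_monotone_convergence_SUP)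
      (auto simp: incseq_def le_fun_def intro!: mult_left_mono U)
  also have "\<dots> = (SUP i. \<integral>\<^sup>+x. transfer M r \<Delta> 1 (U i) x \<partial>\<mu>)"
    by (simp only: IH)
  also have "\<dots> = (\<integral>\<^sup>+x. (SUP i. transfer M r \<Delta> 1 (U i) x) \<partial>\<mu>)"
  proof (rule nn_integral_monotone_convergence_SUP[symmetric])
    show "incseq (\<lambda>i. transfer M r \<Delta> 1 (U i))"
      by (auto simp: incseq_def le_fun_def transfer_def intro!: sum_mono mult_left_mono U)
  qed measurable
  \<comment> \<open>Within one fiber, suprema of increasing sequences commute with the weights and
    with the sum.\<close>
  also have "(\<lambda>x. SUP i. transfer M r \<Delta> 1 (U i) x) = transfer M r \<Delta> 1 (SUP i. U i)"
  proof
    fix x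
    have "(SUP i. transfer M r \<Delta> 1 (U i) x) =
        (\<Sum>y\<in>fiber M r x. SUP i. ennreal (cocycle r \<Delta> 1 y) * U i y)"
      unfolding transfer_def
      by (rule ennreal_SUP_sum) (auto simp: incseq_def intro!: mult_left_mono U)
    then show "(SUP i. transfer M r \<Delta> 1 (U i) x) = transfer M r \<Delta> 1 (SUP i. U i) x"
      by (simp add: transfer_def SUP_mult_left_ennreal image_comp)
  qed
  finally show ?case .
qed

section \<open>Coordinate laws under a quasi-invariant measure\<close>

lemma distr_Suc_coordinate:
  assumes V: "V \<in> borel_measurable M" and \<nu>: "quasi_invariant M r V \<nu>"
  shows "distr \<nu> M (\<lambda>x. x (Suc n)) = distr (density \<nu> (\<lambda>x. ennreal (V (x 0)))) M (\<lambda>x. x n)"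
proof (rule measure_eqI)
  have sets: "sets \<nu> = sets (path_algebra M r)"
    using \<nu> by (simp add: quasi_invariant_def)
  have sp: "space \<nu> = path_space M r"
    using sets_eq_imp_space_eq[OF sets] by simp
  have coord: "(\<lambda>x. x k) \<in> \<nu> \<rightarrow>\<^sub>M M" for k
    using measurable_coordinate measurable_cong_sets[OF sets refl] by blast
  fix B assume "B \<in> sets (distr \<nu> M (\<lambda>x. x (Suc n)))"
  then have B: "B \<in> sets M" by simp
  \<comment> \<open>The cylinder at index \<open>Suc n\<close> is the \<open>path_map\<close> image
    of the one at index \<open>n\<close>, so quasi-invariance evaluates its mass with density
    \<open>V (x 0)\<close>.\<close>
  have "emeasure (distr \<nu> M (\<lambda>x. x (Suc n))) B =
      emeasure \<nu> (path_map r ` ((\<lambda>x. x n) -` B \<inter> path_space M r))"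
    by (simp add: emeasure_distr[OF coord B] path_map_cylinder[OF r_space] sp)
  also have "\<dots> = emeasure (density \<nu> (\<lambda>x. ennreal (V (x 0)))) ((\<lambda>x. x n) -` B \<inter> path_space M r)"
    using \<nu> cylinder_in_path_algebra[OF B, of n r] by (simp add: quasi_invariant_def sets)
  also have "\<dots> = emeasure (distr (density \<nu> (\<lambda>x. ennreal (V (x 0)))) M (\<lambda>x. x n)) B"
    using coord B by (subst emeasure_distr) (simp_all add: sp)
  finally show "emeasure (distr \<nu> M (\<lambda>x. x (Suc n))) B =
    emeasure (distr (density \<nu> (\<lambda>x. ennreal (V (x 0)))) M (\<lambda>x. x n)) B" .
qed simp

lemma nn_integral_coordinate:
  assumes V: "V \<in> borel_measurable M" "\<And>x. x \<in> space M \<Longrightarrow> 0 \<le> V x" "\<And>x. x \<in> space M \<Longrightarrow> V x \<le> C"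
    and \<mu>: "finite_measure \<mu>" "sets \<mu> = sets M"
    and \<Delta>: "associated_function M r V \<mu> \<Delta>"
    and \<nu>: "quasi_invariant M r V \<nu>" "distr \<nu> M (\<lambda>x. x 0) = \<mu>"
    and g: "g \<in> borel_measurable M"
  shows "(\<integral>\<^sup>+x. g (x n) \<partial>\<nu>) = (\<integral>\<^sup>+x. transfer M r \<Delta> n g x \<partial>\<mu>)"
  using g
proof (induction n arbitrary: g)
  have sets: "sets \<nu> = sets (path_algebra M r)"
    using \<nu> by (simp add: quasi_invariant_def)
  have sp\<nu>: "space \<nu> = path_space M r"
    using sets_eq_imp_space_eq[OF sets] by simp
  have sp: "space \<mu> = space M" by (rule sets_eq_imp_space_eq) fact
  have coord: "(\<lambda>x. x k) \<in> \<nu> \<rightarrow>\<^sub>M M" for k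
    using measurable_coordinate measurable_cong_sets[OF sets refl] by blast
  {
    case 0
    have "(\<integral>\<^sup>+x. g (x 0) \<partial>\<nu>) = (\<integral>\<^sup>+x. g x \<partial>\<mu>)"
      unfolding \<nu>(2)[symmetric] using coord 0 by (subst nn_integral_distr) simp_all
    also have "\<dots> = (\<integral>\<^sup>+x. transfer M r \<Delta> 0 g x \<partial>\<mu>)"
      by (intro nn_integral_cong) (simp add: sp transfer_0)
    finally show ?case .
  next
    case (Suc n)
    have "(\<integral>\<^sup>+x. g (x (Suc n)) \<partial>\<nu>) = (\<integral>\<^sup>+x. g x \<partial>distr \<nu> M (\<lambda>x. x (Suc n)))"
      using coord Suc.prems by (subst nn_integral_distr) simp_all
    also have "\<dots> = (\<integral>\<^sup>+x. g (x n) \<partial>density \<nu> (\<lambda>x. ennreal (V (x 0))))"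
      unfolding distr_Suc_coordinate[OF V(1) \<nu>(1)]
      using coord Suc.prems by (subst nn_integral_distr) simp_all
    also have "\<dots> = (\<integral>\<^sup>+x. ennreal (V (x 0)) * g (x n) \<partial>\<nu>)"
      using measurable_compose[OF coord V(1)] measurable_compose[OF coord Suc.prems]
      by (intro nn_integral_density) simp_all
    \<comment> \<open>On a path \<open>x 0 = (r ^^ n) (x n)\<close>, so the whole integrand is a
      function of \<open>x n\<close> alone. The induction hypothesis applies to this new function,
      which is why \<open>g\<close> is kept arbitrary.\<close>
    also have "\<dots> = (\<integral>\<^sup>+x. ennreal (V ((r ^^ n) (x n))) * g (x n) \<partial>\<nu>)"
      using path_space_funpow[of _ M r n 0] by (intro nn_integral_cong) (simp add: sp\<nu>)
    also have "\<dots> = (\<integral>\<^sup>+x. transfer M r \<Delta> n (\<lambda>y. ennreal (V ((r ^^ n) y)) * g y) x \<partial>\<mu>)"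
      using measurable_compose[OF measurable_funpow_r V(1)] Suc.prems
      by (intro Suc.IH) simp
    also have "\<dots> = (\<integral>\<^sup>+x. ennreal (V x) * transfer M r \<Delta> n g x \<partial>\<mu>)"
      by (simp add: transfer_funpow_mult[where v = "\<lambda>x. ennreal (V x)"])
    also have "\<dots> = (\<integral>\<^sup>+x. transfer M r \<Delta> 1 (transfer M r \<Delta> n g) x \<partial>\<mu>)"
      by (rule nn_integral_transfer[OF V \<mu> \<Delta>
            measurable_transfer[OF associated_functionD(1,2)[OF \<Delta>] Suc.prems]])
    also have "\<dots> = (\<integral>\<^sup>+x. transfer M r \<Delta> (Suc n) g x \<partial>\<mu>)"
      using transfer_Suc[OF _ associated_functionD(2)[OF \<Delta>]]
      by (intro nn_integral_cong) (simp only: sp)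
    finally show ?case .
  }
qed

section \<open>The kernel formed by the path measures\<close>

lemma path_measure_coordinate:
  assumes x: "x \<in> space M" and \<Delta>: "\<And>x. x \<in> space M \<Longrightarrow> 0 \<le> \<Delta> x"
    and P: "path_measure M r \<Delta> x P"
  shows "emeasure P {\<omega> \<in> Omega M r x. \<omega> k \<in> B} = transfer M r \<Delta> (Suc k) (indicator B) x"
proof -
  let ?E = "{\<omega> \<in> Omega M r x. \<omega> k \<in> B}" and ?n = "Suc k"
  interpret prob_space P
    by (rule path_measureD(1)[OF P])
  note sp = path_measureD(3)[OF P]
  have E: "?E \<in> sets P"
    unfolding path_measureD(2)[OF P] by (rule Omega_coordinate_borel)
  \<comment> \<open>A test function that reads only the last entry of the list: for
    \<open>map \<omega> [0..<?n]\<close> this is \<open>\<omega> k\<close>, and in the defining sum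
    it is \<open>(r ^^ 0) y = y\<close>.\<close>
  define g :: "'a list \<Rightarrow> complex" where "g l = indicator B (last l)" for l
  have gP: "g (map \<omega> [0..<?n]) = indicator ?E \<omega>" if "\<omega> \<in> space P" for \<omega>
    using that by (simp add: g_def sp indicator_def)
  have "(\<integral>\<omega>. g (map \<omega> [0..<?n]) \<partial>P) = (\<integral>\<omega>. indicator ?E \<omega> \<partial>P)"
    by (rule Bochner_Integration.integral_cong[OF refl gP])
  also have "\<dots> = complex_of_real (measure P ?E)"
    using E by (subst of_real_indicator[symmetric]) simp
  finally have "complex_of_real (measure P ?E) = (\<integral>\<omega>. g (map \<omega> [0..<?n]) \<partial>P)" by simp
  also have "\<dots> = (\<Sum>y\<in>iter_fiber M r ?n x. complex_of_real (cocycle r \<Delta> ?n y) *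
      g (map (\<lambda>k. (r ^^ (?n - k)) y) [1..<Suc ?n]))"
  proof (rule path_measureD(4)[OF P])
    show "(\<lambda>\<omega>. g (map \<omega> [0..<?n])) \<in> borel_measurable P"
      by (rule measurable_cong[THEN iffD2, OF gP borel_measurable_indicator[OF E]])
    show "\<exists>C. \<forall>\<omega>\<in>Omega M r x. norm (g (map \<omega> [0..<?n])) \<le> C"
      by (rule exI[of _ 1]) (simp add: g_def indicator_def)
  qed simp
  also have "\<dots> = complex_of_real (\<Sum>y\<in>iter_fiber M r ?n x. cocycle r \<Delta> ?n y * indicator B y)"
    by (simp add: g_def of_real_indicator)
  finally have "measure P ?E = (\<Sum>y\<in>iter_fiber M r ?n x. cocycle r \<Delta> ?n y * indicator B y)"
    by (simp only: of_real_eq_iff)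
  then have "emeasure P ?E = ennreal (\<Sum>y\<in>iter_fiber M r ?n x. cocycle r \<Delta> ?n y * indicator B y)"
    by (simp add: emeasure_eq_measure)
  also have "\<dots> = (\<Sum>y\<in>iter_fiber M r ?n x. ennreal (cocycle r \<Delta> ?n y * indicator B y))"
    using cocycle_nonneg[OF r_space \<Delta>]
    by (intro sum_ennreal[symmetric]) (simp add: iter_fiber_def)
  also have "\<dots> = transfer M r \<Delta> ?n (indicator B) x"
    unfolding transfer_def by (intro sum.cong) (auto simp: indicator_def)
  finally show ?thesis .
qed

text \<open>The law of the full path starting at \<open>x\<close>. The measures \<open>P x\<close>
  live on different spaces \<open>Omega M r x\<close>; transported to the common path algebra they
  can be integrated over \<open>x\<close>.\<close>

definition path_kernel :: "('a \<Rightarrow> (nat \<Rightarrow> 'a) measure) \<Rightarrow> 'a \<Rightarrow> (nat \<Rightarrow> 'a) measure" where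
  "path_kernel P x = distr (P x) (path_algebra M r) (case_nat x)"

context
  fixes \<Delta> :: "'a \<Rightarrow> real" and P :: "'a \<Rightarrow> (nat \<Rightarrow> 'a) measure"
  assumes \<Delta>_measurable: "\<Delta> \<in> borel_measurable M"
    and \<Delta>_nonneg: "\<And>x. x \<in> space M \<Longrightarrow> 0 \<le> \<Delta> x"
    and path_measure_P: "\<And>x. x \<in> space M \<Longrightarrow> path_measure M r \<Delta> x (P x)"
begin

lemma measurable_case_nat_P: "x \<in> space M \<Longrightarrow> case_nat x \<in> P x \<rightarrow>\<^sub>M path_algebra M r"
  by (rule measurable_case_nat_Omega[OF _ path_measureD(2)[OF path_measure_P]])

lemma prob_space_path_kernel: "x \<in> space M \<Longrightarrow> prob_space (path_kernel P x)"
  unfolding path_kernel_def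
  by (rule prob_space.prob_space_distr[OF path_measureD(1)[OF path_measure_P] measurable_case_nat_P])

text \<open>At index 0 the path sits at \<open>x\<close> with probability 1, matching the zeroth
  transfer power; at index \<open>Suc k\<close> the coordinate is \<open>\<omega> k\<close>, whose
  law is given by \<open>path_measure_coordinate\<close>.\<close>

lemma emeasure_path_kernel_cylinder:
  assumes x: "x \<in> space M" and B: "B \<in> sets M"
  shows "emeasure (path_kernel P x) ((\<lambda>z. z n) -` B \<inter> path_space M r) =
    transfer M r \<Delta> n (indicator B) x"
proof -
  note Px = path_measure_P[OF x]
  interpret prob_space "P x"
    by (rule path_measureD(1)[OF Px])
  note sp = path_measureD(3)[OF Px]
  have eq: "emeasure (path_kernel P x) ((\<lambda>z. z n) -` B \<inter> path_space M r) =
      emeasure (P x) {\<omega> \<in> Omega M r x. case_nat x \<omega> n \<in> B}"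
  proof -
    have "case_nat x -` ((\<lambda>z. z n) -` B \<inter> path_space M r) \<inter> space (P x) =
        {\<omega> \<in> Omega M r x. case_nat x \<omega> n \<in> B}"
      using case_nat_in_path_space[OF x] by (auto simp: sp)
    then show ?thesis
      unfolding path_kernel_def
      by (simp only: emeasure_distr[OF measurable_case_nat_P[OF x] cylinder_in_path_algebra[OF B]])
  qed
  show ?thesis
  proof (cases n)
    case 0
    then show ?thesis
      unfolding eq using x emeasure_space_1 by (cases "x \<in> B") (simp_all add: transfer_0 sp)
  next
    case (Suc k)
    then show ?thesis
      unfolding eq using path_measure_coordinate[OF x \<Delta>_nonneg Px] by simp
  qed
qed

lemma sets_path_kernel: "sets (path_kernel P x) = sets (path_algebra M r)"
  by (simp add: path_kernel_def)

text \<open>Measurable dependence of \<open>P x\<close> on \<open>x\<close> is derived, not assumed.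
  For probability measures it can be checked on an Int-stable generator, where the mass is a
  transfer of an indicator.\<close>

lemma measurable_path_kernel: "path_kernel P \<in> M \<rightarrow>\<^sub>M subprob_algebra (path_algebra M r)"
proof (rule measurable_prob_algebraD,
    rule measurable_prob_algebra_generated[OF sets_path_algebra Int_stable_cylinders cylinders_subset])
  fix A assume "A \<in> cylinders M r"
  then obtain n B where "A = (\<lambda>x. x n) -` B \<inter> path_space M r" "B \<in> sets M"
    by (auto simp: cylinders_def)
  then show "(\<lambda>x. emeasure (path_kernel P x) A) \<in> borel_measurable M"
    using measurable_transfer[OF \<Delta>_measurable \<Delta>_nonneg, of "indicator B" n]
    by (simp add: emeasure_path_kernel_cylinder cong: measurable_cong)
qed (simp_all add: prob_space_path_kernel sets_path_kernel)

text \<open>Both measures give the cylinder over \<open>B\<close> at index \<open>n\<close> the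
  integral of \<open>transfer M r \<Delta> n (indicator B)\<close>, and measures agreeing on an
  Int-stable generator coincide once it exhausts the space by sets of finite mass.\<close>

lemma eq_bind_path_kernel:
  assumes V: "V \<in> borel_measurable M" "\<And>x. x \<in> space M \<Longrightarrow> 0 \<le> V x" "\<And>x. x \<in> space M \<Longrightarrow> V x \<le> C"
    and \<mu>: "finite_measure \<mu>" "sets \<mu> = sets M"
    and \<Delta>: "associated_function M r V \<mu> \<Delta>"
    and \<nu>: "finite_measure \<nu>" "quasi_invariant M r V \<nu>" "distr \<nu> M (\<lambda>x. x 0) = \<mu>"
  shows "\<nu> = \<mu> \<bind> path_kernel P"
proof (rule measure_eqI_generator_eq[OF Int_stable_cylinders cylinders_subset])
  have sets: "sets \<nu> = sets (path_algebra M r)"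
    using \<nu> by (simp add: quasi_invariant_def)
  have sp\<nu>: "space \<nu> = path_space M r"
    using sets_eq_imp_space_eq[OF sets] by simp
  have sp: "space \<mu> = space M" by (rule sets_eq_imp_space_eq) fact
  have K: "path_kernel P \<in> \<mu> \<rightarrow>\<^sub>M subprob_algebra (path_algebra M r)"
    using measurable_path_kernel by (simp cong: measurable_cong_sets add: \<mu>(2))
  show "sets \<nu> = sigma_sets (path_space M r) (cylinders M r)"
    by (simp add: sets sets_path_algebra)
  \<comment> \<open>Over an empty space \<open>bind\<close> takes the default value
    \<open>count_space {}\<close>; \<open>nonempty\<close> excludes this.\<close>
  show "sets (\<mu> \<bind> path_kernel P) = sigma_sets (path_space M r) (cylinders M r)"
    using nonempty by (subst sets_bind[of _ _ "path_algebra M r"])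
      (auto simp: sp sets_path_algebra sets_path_kernel)
  show "emeasure \<nu> A = emeasure (\<mu> \<bind> path_kernel P) A" if A': "A \<in> cylinders M r" for A
  proof -
    obtain n B where A: "A = (\<lambda>x. x n) -` B \<inter> path_space M r" and B: "B \<in> sets M"
      using A' unfolding cylinders_def by blast
    have "emeasure \<nu> A = (\<integral>\<^sup>+x. indicator A x \<partial>\<nu>)"
      using cylinder_in_path_algebra[OF B, of n r] by (simp add: A sets)
    also have "\<dots> = (\<integral>\<^sup>+x. indicator B (x n) \<partial>\<nu>)"
      by (intro nn_integral_cong) (simp add: A sp\<nu> indicator_def)
    also have "\<dots> = (\<integral>\<^sup>+x. transfer M r \<Delta> n (indicator B) x \<partial>\<mu>)"
      by (rule nn_integral_coordinate[OF V \<mu> \<Delta> \<nu>(2,3) borel_measurable_indicator[OF B]])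
    also have "\<dots> = (\<integral>\<^sup>+x. emeasure (path_kernel P x) A \<partial>\<mu>)"
      by (intro nn_integral_cong) (simp add: A sp emeasure_path_kernel_cylinder[OF _ B])
    also have "\<dots> = emeasure (\<mu> \<bind> path_kernel P) A"
      using nonempty cylinder_in_path_algebra[OF B, of n r]
      by (subst emeasure_bind[OF _ K]) (simp_all add: A sp)
    finally show ?thesis .
  qed
  \<comment> \<open>The exhausting sequence is constant: the whole path space is itself a cylinder,
    of finite mass.\<close>
  have "(\<lambda>x. x 0) -` space M \<inter> path_space M r = path_space M r"
    by (auto simp: path_space_def)
  then show "range (\<lambda>_::nat. path_space M r) \<subseteq> cylinders M r"
    unfolding cylinders_def by blast
  show "emeasure \<nu> (path_space M r) \<noteq> \<infinity>"
    using finite_measure.emeasure_finite[OF \<nu>(1)] by simp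
qed auto

end

end

section \<open>Complex integrals against the mixture of the kernel\<close>

lemma integral_bind_complex:
  fixes f :: "'b \<Rightarrow> complex"
  assumes f: "f \<in> borel_measurable K" "\<And>x. x \<in> space K \<Longrightarrow> norm (f x) \<le> C"
    and N: "N \<in> M \<rightarrow>\<^sub>M subprob_algebra K" and M: "finite_measure M"
  shows "(\<integral>y. f y \<partial>(M \<bind> N)) = (\<integral>x. \<integral>y. f y \<partial>N x \<partial>M)"
proof -
  interpret finite_measure M by fact
  have sub: "subprob_space (N x)" and sets: "sets (N x) = sets K" if "x \<in> space M" for x
    using measurable_space[OF N that] by (auto simp: space_subprob_algebra)
  have bound: "AE x in M. emeasure (N x) (space (N x)) \<le> ennreal 1"
    using subprob_space.subprob_emeasure_le_1[OF sub] by auto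
  \<comment> \<open>Real and imaginary parts are treated separately by \<open>integral_bind\<close>;
    boundedness and finite total mass give the integrability that lets \<open>Re\<close> and
    \<open>Im\<close> pass through the integrals.\<close>
  have Re: "\<bar>Re (f x)\<bar> \<le> C" and Im: "\<bar>Im (f x)\<bar> \<le> C" if "x \<in> space K" for x
    using f(2)[OF that] abs_Re_le_cmod[of "f x"] abs_Im_le_cmod[of "f x"] by linarith+
  have m: "(\<lambda>x. Re (f x)) \<in> borel_measurable K" "(\<lambda>x. Im (f x)) \<in> borel_measurable K"
    using f(1) by measurable
  have i: "integrable (N x) f" if "x \<in> space M" for x
  proof -
    interpret subprob_space "N x" by (rule sub[OF that])
    show ?thesis
      using f sets[OF that] sets_eq_imp_space_eq[OF sets[OF that]]
      by (intro integrable_const_bound[of _ C]) (auto cong: measurable_cong_sets)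
  qed
  note Rei = integrable_bind[OF m(1) Re N M bound] and Imi = integrable_bind[OF m(2) Im N M bound]
  have bi: "integrable (M \<bind> N) f"
  proof -
    have "integrable (M \<bind> N) (\<lambda>x. complex_of_real (Re (f x)) + \<i> * complex_of_real (Im (f x)))"
      using Rei Imi by (intro Bochner_Integration.integrable_add integrable_mult_right integrable_of_real)
    then show ?thesis by (simp flip: complex_eq)
  qed
  \<comment> \<open>\<open>\<bar>C\<bar>\<close> is nonnegative, so multiplying it by a total mass
    of at most 1 cannot increase it.\<close>
  have norm: "norm (\<integral>y. f y \<partial>N x) \<le> \<bar>C\<bar>" if "x \<in> space M" for x
  proof -
    interpret subprob_space "N x" by (rule sub[OF that])
    have "norm (\<integral>y. f y \<partial>N x) \<le> (\<integral>y. \<bar>C\<bar> \<partial>N x)"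
      using i[OF that] f(2) sets_eq_imp_space_eq[OF sets[OF that]]
      by (intro order_trans[OF integral_norm_bound] integral_mono)
        (auto intro: order_trans[OF _ abs_ge_self])
    also have "\<dots> = \<bar>C\<bar> * measure (N x) (space (N x))" by simp
    also have "\<dots> \<le> \<bar>C\<bar>"
      using subprob_measure_le_1 by (intro mult_left_le) auto
    finally show ?thesis .
  qed
  have Fi: "integrable M (\<lambda>x. \<integral>y. f y \<partial>N x)"
    using measurable_compose[OF N integral_measurable_subprob_algebra[OF f(1)]] norm
    by (intro integrable_const_bound[of _ "\<bar>C\<bar>"]) auto
  show ?thesis
  proof (rule complex_eqI)
    have "Re (\<integral>y. f y \<partial>(M \<bind> N)) = (\<integral>x. \<integral>y. Re (f y) \<partial>N x \<partial>M)"
      using integral_bind[OF m(1) Re N M bound] bi by simp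
    also have "\<dots> = (\<integral>x. Re (\<integral>y. f y \<partial>N x) \<partial>M)"
      using i by (intro Bochner_Integration.integral_cong) auto
    finally show "Re (\<integral>y. f y \<partial>(M \<bind> N)) = Re (\<integral>x. \<integral>y. f y \<partial>N x \<partial>M)"
      using Fi by simp
    have "Im (\<integral>y. f y \<partial>(M \<bind> N)) = (\<integral>x. \<integral>y. Im (f y) \<partial>N x \<partial>M)"
      using integral_bind[OF m(2) Im N M bound] bi by simp
    also have "\<dots> = (\<integral>x. Im (\<integral>y. f y \<partial>N x) \<partial>M)"
      using i by (intro Bochner_Integration.integral_cong) auto
    finally show "Im (\<integral>y. f y \<partial>(M \<bind> N)) = Im (\<integral>x. \<integral>y. f y \<partial>N x \<partial>M)"
      using Fi by simp
  qed
qed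

theorem theorem5p8p12:
  fixes M \<mu>\<^sub>0 :: "'a measure"
    and r :: "'a \<Rightarrow> 'a"
    and V \<Delta> :: "'a \<Rightarrow> real"
    and \<mu>_hat :: "(nat \<Rightarrow> 'a) measure"
    and P :: "'a \<Rightarrow> (nat \<Rightarrow> 'a) measure"
    and f :: "(nat \<Rightarrow> 'a) \<Rightarrow> complex"
  assumes "finite_to_one_endomorphism M r"
    and "V \<in> borel_measurable M"
    and "\<forall>x\<in>space M. 0 \<le> V x"
    and "\<exists>C. \<forall>x\<in>space M. V x \<le> C"
    and "finite_measure \<mu>\<^sub>0" and "sets \<mu>\<^sub>0 = sets M"
    and "fixed_point_property r V \<mu>\<^sub>0"
    and "associated_function M r V \<mu>\<^sub>0 \<Delta>"
    and "finite_measure \<mu>_hat"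
    and "quasi_invariant M r V \<mu>_hat"
    and "distr \<mu>_hat M (\<lambda>x. x 0) = \<mu>\<^sub>0"
    and "\<forall>x\<in>space M. path_measure M r \<Delta> x (P x)"
    and "f \<in> borel_measurable (path_algebra M r)"
    and "\<exists>C. \<forall>x\<in>path_space M r. norm (f x) \<le> C"
  shows "(\<integral>x. f x \<partial>\<mu>_hat) = (\<integral>x. (\<integral>\<omega>. f (case_nat x \<omega>) \<partial>(P x)) \<partial>\<mu>\<^sub>0)"
proof -
  interpret finite_to_one_endomorphism M r by fact
  obtain C where V: "\<And>x. x \<in> space M \<Longrightarrow> 0 \<le> V x" "\<And>x. x \<in> space M \<Longrightarrow> V x \<le> C"
    using assms(3,4) by auto
  obtain D where f: "\<And>x. x \<in> space (path_algebra M r) \<Longrightarrow> norm (f x) \<le> D"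
    using assms(14) by auto
  note \<Delta> = associated_functionD(1,2)[OF assms(8)]
  have P: "\<And>x. x \<in> space M \<Longrightarrow> path_measure M r \<Delta> x (P x)"
    using assms(12) by blast
  have sp: "space \<mu>\<^sub>0 = space M" by (rule sets_eq_imp_space_eq) fact
  have K: "path_kernel P \<in> \<mu>\<^sub>0 \<rightarrow>\<^sub>M subprob_algebra (path_algebra M r)"
    using measurable_path_kernel[OF \<Delta> P] by (simp cong: measurable_cong_sets add: assms(6))
  have "(\<integral>x. f x \<partial>\<mu>_hat) = (\<integral>x. f x \<partial>(\<mu>\<^sub>0 \<bind> path_kernel P))"
    using eq_bind_path_kernel[OF \<Delta> P assms(2) V assms(5,6,8,9,10,11)] by simp
  also have "\<dots> = (\<integral>x. \<integral>z. f z \<partial>path_kernel P x \<partial>\<mu>\<^sub>0)"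
    by (rule integral_bind_complex[OF assms(13) f K assms(5)])
  \<comment> \<open>The kernel at \<open>x\<close> is the image of \<open>P x\<close> under
    \<open>case_nat x\<close>, so a change of variables returns to
    \<open>Omega M r x\<close>.\<close>
  also have "\<dots> = (\<integral>x. (\<integral>\<omega>. f (case_nat x \<omega>) \<partial>(P x)) \<partial>\<mu>\<^sub>0)"
    unfolding path_kernel_def using measurable_case_nat_P[OF \<Delta> P] assms(13)
    by (intro Bochner_Integration.integral_cong integral_distr) (auto simp: sp)
  finally show ?thesis .
qed

end
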